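(* Let $0<r<R$ and $M>0$. If $u$ is a complex-valued harmonic mapping in the disk $B^2(a,R)$ such that $|u(w)|\le M$ for all $w\in B^2(a,R)$, then $$\left|u(a+z)-\frac{R^2-|z|^2}{R^2+|z|^2}u(a)\right|\le\frac{2M}{\pi}\arctan\left(\frac{2R|z|}{R^2-|z|^2}\right),\quad z=re^{it}.$$ The result is sharp.
   Context: $B^2(a,R)=\{w:|w-a|<R\}$ is the open disk with center $a$ and radius $R$ in the complex plane $\mathbb{C}$, identified with $\mathbb{R}^2$; $t$ is real. A complex-valued function is harmonic if its real and imaginary parts are both harmonic, i.e. twice continuously differentiable and satisfying the Laplace equation. *)

theory Defs
  imports "HOL-Analysis.Analysis"
begin

definition partial_x :: "(complex \<Rightarrow> real) \<Rightarrow> complex \<Rightarrow> real" where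
  "partial_x f w = frechet_derivative f (at w) 1"

definition partial_y :: "(complex \<Rightarrow> real) \<Rightarrow> complex \<Rightarrow> real" where
  "partial_y f w = frechet_derivative f (at w) \<i>"

text \<open>
  All notions below are meant for open \<open>S\<close>.  The term \<open>frechet_derivative\<close> is unspecified where
  \<open>f\<close> is not differentiable, so differentiability is always demanded explicitly; it is real
  (Frechet) differentiability in the plane, not complex differentiability.
\<close>

definition C1_on :: "complex set \<Rightarrow> (complex \<Rightarrow> real) \<Rightarrow> bool" where
  "C1_on S f \<longleftrightarrow>
     (\<forall>w\<in>S. f differentiable (at w)) \<and>
     continuous_on S (partial_x f) \<and> continuous_on S (partial_y f)"

definition C2_on :: "complex set \<Rightarrow> (complex \<Rightarrow> real) \<Rightarrow> bool" where
  "C2_on S f \<longleftrightarrow> C1_on S f \<and> C1_on S (partial_x f) \<and> C1_on S (partial_y f)"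

definition laplacian :: "(complex \<Rightarrow> real) \<Rightarrow> complex \<Rightarrow> real" where
  "laplacian f w = partial_x (partial_x f) w + partial_y (partial_y f) w"

definition real_harmonic_on :: "complex set \<Rightarrow> (complex \<Rightarrow> real) \<Rightarrow> bool" where
  "real_harmonic_on S f \<longleftrightarrow> C2_on S f \<and> (\<forall>w\<in>S. laplacian f w = 0)"

definition harmonic_mapping_on :: "complex set \<Rightarrow> (complex \<Rightarrow> complex) \<Rightarrow> bool" where
  "harmonic_mapping_on S u \<longleftrightarrow>
     real_harmonic_on S (\<lambda>w. Re (u w)) \<and> real_harmonic_on S (\<lambda>w. Im (u w))"

end

theory Submission
  imports Defs "HOL-Complex_Analysis.Cauchy_Integral_Formula"
begin

text \<open>
  Write \<open>\<rho>\<close> for \<open>\<bar>z\<bar>\<close>.  On a circle of radius \<open>s\<close> with \<open>\<rho> < s < R\<close> the Poisson formula represents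
  \<open>u (a + z) - c u a\<close>, with \<open>c = (s\<^sup>2 - \<rho>\<^sup>2) / (s\<^sup>2 + \<rho>\<^sup>2)\<close>, as the mean of \<open>(P - c) u\<close>, where \<open>P\<close> is the
  Poisson kernel of \<open>z\<close>.  The constant \<open>c\<close> is the value of \<open>P\<close> at the two boundary points orthogonal to
  the direction of \<open>z\<close>, so \<open>P - c\<close> is nonnegative on the half circle facing \<open>z\<close> and
  nonpositive on the opposite one.  Hence the modulus is at most \<open>M\<close> times the mean of \<open>\<bar>P - c\<bar>\<close>, and after
  antipodal points are paired this is, up to the factor \<open>M / (2 \<pi>)\<close>, the integral over a half circle of a difference of two values of
  \<open>P\<close>, in which \<open>c\<close> cancels.  That difference has an \<open>arctan\<close> as antiderivative
  (\<open>centered_poisson_kernel_integral\<close>).  Letting \<open>s\<close> tend to \<open>R\<close> gives the bound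
  (\<open>harmonic_deviation_bound\<close>).

  The bound would be attained by the harmonic function whose boundary values are \<open>M\<close> where \<open>P > c\<close> and
  \<open>-M\<close> where \<open>P < c\<close>.  This function is the real part of a scaled complex arctangent
  (\<open>harmonic_deviation_extremal\<close>); it vanishes at \<open>a\<close>, and its value at \<open>a + z\<close> is the right-hand side by
  the double angle formula for \<open>arctan\<close>.

  The Poisson formula comes from Cauchy's integral formula, once a harmonic function on a disk is
  known to be the real part of a holomorphic function.  This is \<open>real_harmonic_is_Re_holomorphic\<close>, which
  in turn rests on the equality of the mixed second derivatives.
\<close>

section \<open>Symmetry of mixed partial derivatives\<close>

text \<open>
  The mean value theorem is used twice: in the direction \<open>d\<close> for the difference of two parallel
  sides, then in the direction \<open>e\<close> for the derivative of \<open>f\<close> along \<open>d\<close>.  The left-hand side is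
  symmetric in \<open>d\<close> and \<open>e\<close> while the right-hand side is not, which is what makes mixed
  derivatives commute.
\<close>

lemma second_difference_mean_value:
  fixes f :: "complex \<Rightarrow> real" and w d e :: complex and s :: real
  assumes "0 < s"
    and box: "\<And>x y. 0 \<le> x \<Longrightarrow> x \<le> s \<Longrightarrow> 0 \<le> y \<Longrightarrow> y \<le> s \<Longrightarrow> w + of_real x * d + of_real y * e \<in> S"
    and f: "\<And>p. p \<in> S \<Longrightarrow> f differentiable (at p)"
    and f': "\<And>p. p \<in> S \<Longrightarrow> (\<lambda>q. frechet_derivative f (at q) d) differentiable (at p)"
  obtains x y where "0 < x" "x < s" "0 < y" "y < s"
    "f (w + of_real s * d + of_real s * e) - f (w + of_real s * d) - f (w + of_real s * e) + f w
      = s\<^sup>2 * frechet_derivative (\<lambda>q. frechet_derivative f (at q) d)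
                 (at (w + of_real x * d + of_real y * e)) e"
proof -
  define g where "g = (\<lambda>q. frechet_derivative f (at q) d)"
  have D: "((\<lambda>x. h (p + of_real x * v)) has_real_derivative
            frechet_derivative h (at (p + of_real x * v)) v) (at x)"
    if "h differentiable (at (p + of_real x * v))" for h :: "complex \<Rightarrow> real" and p v x
  proof -
    let ?h' = "frechet_derivative h (at (p + of_real x * v))"
    have h: "(h has_derivative ?h') (at (p + of_real x * v))"
      using that by (simp add: frechet_derivative_works)
    have "((\<lambda>x. p + of_real x * v) has_derivative (\<lambda>y. of_real y * v)) (at x)"
      by (auto intro!: derivative_eq_intros)
    from has_derivative_compose[OF this h]
    have "((\<lambda>x. h (p + of_real x * v)) has_derivative (\<lambda>y. ?h' (of_real y * v))) (at x)" .
    moreover have "?h' (of_real y * v) = y * ?h' v" for y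
      using linear_scale[OF has_derivative_linear[OF h], of y v] by (simp add: scaleR_conv_of_real)
    then have "(\<lambda>y. ?h' (of_real y * v)) = (*) (?h' v)" by (simp add: fun_eq_iff)
    ultimately show ?thesis by (simp add: has_field_derivative_def)
  qed
  define \<phi> where "\<phi> = (\<lambda>x. f (w + of_real s * e + of_real x * d) - f (w + of_real x * d))"
  have "(\<phi> has_real_derivative g (w + of_real s * e + of_real x * d) - g (w + of_real x * d)) (at x)"
    if "0 \<le> x" "x \<le> s" for x
    unfolding \<phi>_def g_def using box[of x s] box[of x 0] that \<open>0 < s\<close>
    by (intro DERIV_diff D f) (auto simp: algebra_simps)
  from MVT2[OF \<open>0 < s\<close> this] obtain x where x: "0 < x" "x < s"
    "\<phi> s - \<phi> 0 = s * (g (w + of_real s * e + of_real x * d) - g (w + of_real x * d))"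
    by auto
  have "((\<lambda>y. g (w + of_real x * d + of_real y * e)) has_real_derivative
      frechet_derivative g (at (w + of_real x * d + of_real y * e)) e) (at y)"
    if "0 \<le> y" "y \<le> s" for y
    using box[of x y] that x f' unfolding g_def[symmetric] by (intro D) auto
  from MVT2[OF \<open>0 < s\<close> this] obtain y where y: "0 < y" "y < s"
    "g (w + of_real x * d + of_real s * e) - g (w + of_real x * d + of_real 0 * e)
      = s * frechet_derivative g (at (w + of_real x * d + of_real y * e)) e"
    by auto
  show ?thesis
  proof (rule that[OF x(1,2) y(1,2)], fold g_def)
    have "f (w + of_real s * d + of_real s * e) - f (w + of_real s * d) - f (w + of_real s * e) + f w
        = \<phi> s - \<phi> 0" by (simp add: \<phi>_def algebra_simps)
    also have "\<dots> = s * (s * frechet_derivative g (at (w + of_real x * d + of_real y * e)) e)"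
      using x(3) y(3) by (simp add: algebra_simps)
    finally show "f (w + of_real s * d + of_real s * e) - f (w + of_real s * d) - f (w + of_real s * e) + f w
        = s\<^sup>2 * frechet_derivative g (at (w + of_real x * d + of_real y * e)) e"
      by (simp add: power2_eq_square)
  qed
qed

text \<open>
  The second difference over a small square at \<open>w\<close> equals \<open>s\<^sup>2\<close> times each of the two mixed
  derivatives, taken at two points near \<open>w\<close>.  If the mixed derivatives differed at \<open>w\<close>,
  continuity would keep them apart at all pairs of nearby points.
\<close>

lemma mixed_partials_equal:
  assumes "open S" "C2_on S f" "w \<in> S"
  shows "partial_y (partial_x f) w = partial_x (partial_y f) w"
proof (rule ccontr)
  define A where "A = partial_y (partial_x f)"
  define B where "B = partial_x (partial_y f)"
  assume "partial_y (partial_x f) w \<noteq> partial_x (partial_y f) w"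
  then have pos: "0 < dist (A w) (B w) / 2" by (simp add: A_def B_def)
  have "continuous_on S A" "continuous_on S B"
    using assms(2) by (simp_all add: C2_on_def C1_on_def A_def B_def)
  then have "isCont A w" "isCont B w"
    using assms by (simp_all add: continuous_on_eq_continuous_at)
  from this[unfolded continuous_at_eps_delta] pos
  obtain \<delta>1 \<delta>2 where \<delta>: "\<delta>1 > 0" "\<delta>2 > 0"
    "\<And>p. dist p w < \<delta>1 \<Longrightarrow> dist (A p) (A w) < dist (A w) (B w) / 2"
    "\<And>p. dist p w < \<delta>2 \<Longrightarrow> dist (B p) (B w) < dist (A w) (B w) / 2"
    by metis
  obtain \<delta>3 where \<delta>3: "\<delta>3 > 0" "ball w \<delta>3 \<subseteq> S"
    using assms openE by blast
  define \<delta> where "\<delta> = min \<delta>1 (min \<delta>2 \<delta>3)"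
  define s where "s = \<delta> / 3"
  have s: "0 < s" using \<delta> \<delta>3 by (simp add: s_def \<delta>_def)
  have near: "dist (w + of_real x * d + of_real y * e) w < \<delta>"
    if "0 \<le> x" "x \<le> s" "0 \<le> y" "y \<le> s" "cmod d = 1" "cmod e = 1" for x y d e
  proof -
    have "dist (w + of_real x * d + of_real y * e) w = cmod (of_real x * d + of_real y * e)"
      by (simp add: dist_norm)
    also have "\<dots> \<le> x + y"
      using norm_triangle_ineq[of "of_real x * d" "of_real y * e"] that by (simp add: norm_mult)
    also have "\<dots> < \<delta>" using that s unfolding s_def by linarith
    finally show ?thesis .
  qed
  have inS: "w + of_real x * d + of_real y * e \<in> S"
    if "0 \<le> x" "x \<le> s" "0 \<le> y" "y \<le> s" "cmod d = 1" "cmod e = 1" for x y d e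
    using near[OF that] \<delta>3(2) by (auto simp: \<delta>_def dist_commute subset_iff)
  have diff: "\<And>p. p \<in> S \<Longrightarrow> f differentiable (at p)"
    "\<And>p. p \<in> S \<Longrightarrow> (\<lambda>q. frechet_derivative f (at q) 1) differentiable (at p)"
    "\<And>p. p \<in> S \<Longrightarrow> (\<lambda>q. frechet_derivative f (at q) \<i>) differentiable (at p)"
    using assms(2) by (auto simp: C2_on_def C1_on_def partial_x_def[abs_def] partial_y_def[abs_def])
  have inS1: "w + of_real x * 1 + of_real y * \<i> \<in> S" "w + of_real x * \<i> + of_real y * 1 \<in> S"
    if "0 \<le> x" "x \<le> s" "0 \<le> y" "y \<le> s" for x y
    using inS[OF that, of 1 \<i>] inS[OF that, of \<i> 1] by auto
  obtain x y where 1: "0 < x" "x < s" "0 < y" "y < s"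
    "f (w + of_real s * 1 + of_real s * \<i>) - f (w + of_real s * 1) - f (w + of_real s * \<i>) + f w
      = s\<^sup>2 * A (w + of_real x * 1 + of_real y * \<i>)"
    by (rule second_difference_mean_value[OF s inS1(1) diff(1,2)])
      (auto simp: A_def partial_x_def[abs_def] partial_y_def)
  obtain x' y' where 2: "0 < x'" "x' < s" "0 < y'" "y' < s"
    "f (w + of_real s * \<i> + of_real s * 1) - f (w + of_real s * \<i>) - f (w + of_real s * 1) + f w
      = s\<^sup>2 * B (w + of_real x' * \<i> + of_real y' * 1)"
    by (rule second_difference_mean_value[OF s inS1(2) diff(1,3)])
      (auto simp: B_def partial_x_def partial_y_def[abs_def])
  have "s\<^sup>2 * A (w + of_real x * 1 + of_real y * \<i>) = s\<^sup>2 * B (w + of_real x' * \<i> + of_real y' * 1)"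
    using 1(5) 2(5) by (simp add: algebra_simps)
  with s have "A (w + of_real x * 1 + of_real y * \<i>) = B (w + of_real x' * \<i> + of_real y' * 1)" by simp
  moreover have "dist (A (w + of_real x * 1 + of_real y * \<i>)) (A w) < dist (A w) (B w) / 2"
    using near[of x y 1 \<i>] 1 by (intro \<delta>(3)) (simp add: \<delta>_def)
  moreover have "dist (B (w + of_real x' * \<i> + of_real y' * 1)) (B w) < dist (A w) (B w) / 2"
    using near[of x' y' \<i> 1] 2 by (intro \<delta>(4)) (simp add: \<delta>_def)
  ultimately show False
    using dist_triangle_half_r by fastforce
qed

section \<open>Harmonic functions and real parts of holomorphic functions\<close>

lemma frechet_derivative_partials:
  assumes "f differentiable (at w)"
  shows "frechet_derivative f (at w) v = Re v * partial_x f w + Im v * partial_y f w"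
proof -
  let ?f' = "frechet_derivative f (at w)"
  have lin: "linear ?f'"
    using assms by (rule linear_frechet_derivative)
  have "v = Re v *\<^sub>R 1 + Im v *\<^sub>R \<i>" by (simp add: complex_eq_iff)
  then have "?f' v = ?f' (Re v *\<^sub>R 1 + Im v *\<^sub>R \<i>)" by simp
  also have "\<dots> = Re v * ?f' 1 + Im v * ?f' \<i>"
    by (simp only: linear_add[OF lin] linear_scale[OF lin] real_scaleR_def)
  finally show ?thesis by (simp add: partial_x_def partial_y_def)
qed

text \<open>
  The gradient \<open>h\<^sub>x - \<i> h\<^sub>y\<close> satisfies the Cauchy--Riemann equations: one of them is the Laplace
  equation, the other the symmetry of mixed derivatives.  On a convex set it has a primitive, and
  the real part of a primitive has the same gradient as \<open>h\<close>, so it differs from \<open>h\<close> by a constant.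
\<close>

lemma real_harmonic_is_Re_holomorphic:
  assumes S: "open S" "convex S" and h: "real_harmonic_on S h"
  obtains f where "f holomorphic_on S" "\<And>w. w \<in> S \<Longrightarrow> Re (f w) = h w"
proof (cases "S = {}")
  case True
  then show ?thesis using that[of "\<lambda>_. 0"] by simp
next
  case False
  then obtain c where c: "c \<in> S" by blast
  define g where "g = (\<lambda>w. Complex (partial_x h w) (- partial_y h w))"
  have C2: "C2_on S h" and lap: "\<And>w. w \<in> S \<Longrightarrow> laplacian h w = 0"
    using h by (auto simp: real_harmonic_on_def)
  have diff: "\<And>w. w \<in> S \<Longrightarrow> h differentiable (at w)"
    "\<And>w. w \<in> S \<Longrightarrow> partial_x h differentiable (at w)"
    "\<And>w. w \<in> S \<Longrightarrow> partial_y h differentiable (at w)"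
    using C2 by (auto simp: C2_on_def C1_on_def)
  have "(g has_field_derivative Complex (partial_x (partial_x h) w) (- partial_y (partial_x h) w)) (at w)"
    if w: "w \<in> S" for w
  proof -
    let ?X = "frechet_derivative (partial_x h) (at w)" and ?Y = "frechet_derivative (partial_y h) (at w)"
    have "(partial_x h has_derivative ?X) (at w)" "(partial_y h has_derivative ?Y) (at w)"
      using diff w by (simp_all add: frechet_derivative_works)
    then have "((\<lambda>p. of_real (partial_x h p) - \<i> * of_real (partial_y h p)) has_derivative
        (\<lambda>v. of_real (?X v) - \<i> * of_real (?Y v))) (at w)"
      by (intro derivative_intros)
    moreover have "(\<lambda>p. of_real (partial_x h p) - \<i> * of_real (partial_y h p)) = g"
      by (auto simp: g_def complex_eq_iff)
    moreover have "(\<lambda>v. of_real (?X v) - \<i> * of_real (?Y v))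
        = (*) (Complex (partial_x (partial_x h) w) (- partial_y (partial_x h) w))"
      using lap[OF w] mixed_partials_equal[OF S(1) C2 w]
      by (intro ext) (auto simp: frechet_derivative_partials diff w complex_eq_iff laplacian_def
          algebra_simps eq_neg_iff_add_eq_0[symmetric])
    ultimately show ?thesis
      by (simp add: has_field_derivative_def)
  qed
  then have "g holomorphic_on S"
    using S(1) by (auto simp: holomorphic_on_open)
  then obtain f where f: "\<And>w. w \<in> S \<Longrightarrow> (f has_field_derivative g w) (at w within S)"
    using holomorphic_convex_primitive'[OF S(2,1)] by metis
  have f: "(f has_field_derivative g w) (at w)" if "w \<in> S" for w
    using f[OF that] at_within_open[OF that S(1)] by simp
  have "((\<lambda>w. Re (f w) - h w) has_derivative (\<lambda>v. 0)) (at w)" if w: "w \<in> S" for w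
  proof -
    have "(h has_derivative frechet_derivative h (at w)) (at w)"
      using diff(1)[OF w] by (simp add: frechet_derivative_works)
    moreover have "((\<lambda>w. Re (f w)) has_derivative (\<lambda>v. Re (g w * v))) (at w)"
      using f[OF w] unfolding has_field_derivative_def by (rule has_derivative_Re)
    ultimately have "((\<lambda>w. Re (f w) - h w) has_derivative
        (\<lambda>v. Re (g w * v) - frechet_derivative h (at w) v)) (at w)"
      by (intro has_derivative_diff)
    then show ?thesis
      by (simp add: frechet_derivative_partials diff w g_def algebra_simps)
  qed
  then have const: "Re (f w) - h w = Re (f c) - h c" if "w \<in> S" for w
    using has_derivative_zero_unique[OF S(2), of "\<lambda>w. Re (f w) - h w" w c] that c
    by (metis has_derivative_at_withinI)
  show ?thesis
  proof (rule that[of "\<lambda>w. f w - of_real (Re (f c) - h c)"])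
    show "(\<lambda>w. f w - of_real (Re (f c) - h c)) holomorphic_on S"
      using f S(1) by (intro holomorphic_intros) (auto simp: holomorphic_on_open)
    show "Re (f w - of_real (Re (f c) - h c)) = h w" if "w \<in> S" for w
      using const[OF that] by simp
  qed
qed

lemma partials_Re_holomorphic:
  assumes "open S" "f holomorphic_on S" "w \<in> S"
  shows "(\<lambda>w. Re (f w)) differentiable (at w)"
    "partial_x (\<lambda>w. Re (f w)) w = Re (deriv f w)"
    "partial_y (\<lambda>w. Re (f w)) w = Re (\<i> * deriv f w)"
proof -
  have "(f has_field_derivative deriv f w) (at w)"
    using assms by (simp add: holomorphic_derivI)
  then have *: "((\<lambda>w. Re (f w)) has_derivative (\<lambda>v. Re (deriv f w * v))) (at w)"
    unfolding has_field_derivative_def by (rule has_derivative_Re)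
  show "(\<lambda>w. Re (f w)) differentiable (at w)" using * by (auto simp: differentiable_def)
  show "partial_x (\<lambda>w. Re (f w)) w = Re (deriv f w)"
    "partial_y (\<lambda>w. Re (f w)) w = Re (\<i> * deriv f w)"
    by (simp_all add: partial_x_def partial_y_def frechet_derivative_at[OF *, symmetric])
qed

text \<open>
  Second partial derivatives at a point involve the first ones in a neighbourhood, where they are
  known only through formulas valid on \<open>S\<close>; openness of \<open>S\<close> allows these formulas to be
  differentiated.
\<close>

lemma partials_cong_open:
  assumes "open S" "w \<in> S" "\<And>p. p \<in> S \<Longrightarrow> f p = g p" "g differentiable (at w)"
  shows "f differentiable (at w)" "partial_x f w = partial_x g w" "partial_y f w = partial_y g w"
proof -
  have "(g has_derivative frechet_derivative g (at w)) (at w)"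
    using assms(4) by (simp add: frechet_derivative_works)
  then have *: "(f has_derivative frechet_derivative g (at w)) (at w)"
    by (rule has_derivative_transform_within_open[OF _ assms(1,2)]) (simp add: assms(3))
  then show "f differentiable (at w)" by (auto simp: differentiable_def)
  show "partial_x f w = partial_x g w" "partial_y f w = partial_y g w"
    by (simp_all add: partial_x_def partial_y_def frechet_derivative_at[OF *])
qed

lemma C1_on_Re_holomorphic:
  assumes S: "open S" and F: "F holomorphic_on S" and eq: "\<And>p. p \<in> S \<Longrightarrow> f p = Re (F p)"
  shows "C1_on S f"
    and "\<And>w. w \<in> S \<Longrightarrow> partial_x f w = Re (deriv F w)"
    and "\<And>w. w \<in> S \<Longrightarrow> partial_y f w = Re (\<i> * deriv F w)"
proof -
  note P = partials_Re_holomorphic[OF S F] and Q = partials_cong_open[OF S _ eq partials_Re_holomorphic(1)[OF S F]]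
  show x: "\<And>w. w \<in> S \<Longrightarrow> partial_x f w = Re (deriv F w)"
    and y: "\<And>w. w \<in> S \<Longrightarrow> partial_y f w = Re (\<i> * deriv F w)"
    using P Q by auto
  have "continuous_on S (deriv F)"
    using S F by (intro holomorphic_on_imp_continuous_on holomorphic_deriv)
  then have "continuous_on S (\<lambda>w. Re (deriv F w))" "continuous_on S (\<lambda>w. Re (\<i> * deriv F w))"
    by (auto intro!: continuous_intros)
  then show "C1_on S f"
    unfolding C1_on_def using Q(1) x y by (simp cong: continuous_on_cong)
qed

text \<open>
  Differentiating along the imaginary axis multiplies the complex derivative by \<open>\<i>\<close>; doing so
  twice multiplies the second derivative by \<open>-1\<close>, and the two terms of the Laplacian cancel.
\<close>

lemma real_harmonic_on_Re:
  assumes S: "open S" and F: "F holomorphic_on S"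
  shows "real_harmonic_on S (\<lambda>w. Re (F w))"
proof -
  have F': "deriv F holomorphic_on S" using F S by (rule holomorphic_deriv)
  then have iF': "(\<lambda>w. \<i> * deriv F w) holomorphic_on S"
    by (intro holomorphic_on_mult holomorphic_on_const)
  note f = C1_on_Re_holomorphic[OF S F refl]
  note fx = C1_on_Re_holomorphic[OF S F' f(2)] and fy = C1_on_Re_holomorphic[OF S iF' f(3)]
  have "deriv (\<lambda>w. \<i> * deriv F w) w = \<i> * deriv (deriv F) w" if "w \<in> S" for w
    using F' S that by (simp add: holomorphic_on_imp_differentiable_at)
  then show ?thesis
    unfolding real_harmonic_on_def C2_on_def laplacian_def using f(1) fx fy by simp
qed

section \<open>The Poisson integral formula\<close>

text \<open>
  This is Cauchy's formula at \<open>w\<close> for the function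
  \<open>\<zeta> \<mapsto> f \<zeta> (s\<^sup>2 - \<bar>w\<bar>\<^sup>2) / (s\<^sup>2 - cnj w \<cdot> \<zeta>)\<close>.  The extra factor is holomorphic on the disk and
  equals \<open>1\<close> at \<open>w\<close>; on the circle \<open>\<zeta> \<cdot> cnj \<zeta> = s\<^sup>2\<close>, which turns the Cauchy kernel times this
  factor into the Poisson kernel.
\<close>

lemma poisson_formula_holomorphic:
  fixes f :: "complex \<Rightarrow> complex"
  assumes f: "f holomorphic_on cball 0 s" and w: "cmod w < s"
  shows "((\<lambda>\<theta>. of_real ((s\<^sup>2 - (cmod w)\<^sup>2) / (cmod (s * cis \<theta> - w))\<^sup>2) * f (s * cis \<theta>))
           has_integral of_real (2 * pi) * f w) {0..2*pi}"
proof -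
  have s: "0 < s" using w norm_ge_zero[of w] by linarith
  define q where "q = (\<lambda>\<zeta>. of_real (s\<^sup>2) - cnj w * \<zeta>)"
  have q0: "q \<zeta> \<noteq> 0" if "\<zeta> \<in> cball 0 s" for \<zeta>
  proof
    assume "q \<zeta> = 0"
    then have "cmod (of_real (s\<^sup>2)) = cmod (cnj w * \<zeta>)" by (simp add: q_def)
    then have "s\<^sup>2 = cmod w * cmod \<zeta>" by (simp add: norm_mult norm_power)
    also have "\<dots> \<le> cmod w * s" using that by (intro mult_left_mono) auto
    also have "\<dots> < s\<^sup>2" using w s by (simp add: power2_eq_square)
    finally show False by simp
  qed
  define g where "g = (\<lambda>\<zeta>. f \<zeta> * of_real (s\<^sup>2 - (cmod w)\<^sup>2) / q \<zeta>)"
  have "g holomorphic_on cball 0 s"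
    unfolding g_def q_def using q0 by (intro holomorphic_intros f) (auto simp: q_def)
  from Cauchy_integral_circlepath_simple[OF this] w
  have "((\<lambda>u. g u / (u - w)) has_contour_integral 2 * of_real pi * \<i> * g w) (circlepath 0 s)"
    by simp
  then have "((\<lambda>\<theta>. g (s * cis \<theta>) / (s * cis \<theta> - w) * s * \<i> * cis \<theta>)
      has_integral 2 * of_real pi * \<i> * g w) {0..2*pi}"
    by (simp add: circlepath_def has_contour_integral_part_circlepath_iff)
  from has_integral_mult_right[OF this, of "-\<i>"]
  have "((\<lambda>\<theta>. - \<i> * (g (s * cis \<theta>) / (s * cis \<theta> - w) * s * \<i> * cis \<theta>))
      has_integral - \<i> * (2 * of_real pi * \<i> * g w)) {0..2*pi}" .
  moreover have "- \<i> * (2 * of_real pi * \<i> * g w) = of_real (2 * pi) * g w"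
    by simp
  ultimately have "((\<lambda>\<theta>. - \<i> * (g (s * cis \<theta>) / (s * cis \<theta> - w) * s * \<i> * cis \<theta>))
      has_integral of_real (2 * pi) * g w) {0..2*pi}"
    by (simp only:)
  moreover have "g w = f w"
  proof -
    have "q w = of_real (s\<^sup>2 - (cmod w)\<^sup>2)"
      using complex_norm_square[of w] by (simp add: q_def mult.commute)
    moreover have "q w \<noteq> 0" using q0[of w] w by simp
    ultimately show ?thesis by (simp add: g_def)
  qed
  moreover have "- \<i> * (g (s * cis \<theta>) / (s * cis \<theta> - w) * s * \<i> * cis \<theta>)
      = of_real ((s\<^sup>2 - (cmod w)\<^sup>2) / (cmod (s * cis \<theta> - w))\<^sup>2) * f (s * cis \<theta>)" for \<theta>
  proof -
    define \<zeta> where "\<zeta> = s * cis \<theta>"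
    have "cmod \<zeta> = s" using s by (simp add: \<zeta>_def norm_mult)
    then have \<zeta>\<zeta>: "\<zeta> * cnj \<zeta> = of_real (s\<^sup>2)" using complex_norm_square[of \<zeta>] by simp
    have ne: "\<zeta> \<noteq> w" "\<zeta> \<noteq> 0" using w \<open>cmod \<zeta> = s\<close> s by auto
    have q: "q \<zeta> = \<zeta> * cnj (\<zeta> - w)"
      using \<zeta>\<zeta> by (simp add: q_def algebra_simps)
    have "- \<i> * (g \<zeta> / (\<zeta> - w) * s * \<i> * cis \<theta>) = g \<zeta> / (\<zeta> - w) * \<zeta>"
    proof -
      have "- \<i> * (X * s * \<i> * c) = X * (s * c)" for X c :: complex
        by (simp add: complex_eq_iff)
      then show ?thesis unfolding \<zeta>_def by blast
    qed
    also have "\<dots> = of_real (s\<^sup>2 - (cmod w)\<^sup>2) * f \<zeta> / ((\<zeta> - w) * cnj (\<zeta> - w))"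
    proof -
      have "F * X / (\<zeta> * N) / D * \<zeta> = X * F / (D * N)" for F X N D
        using ne by (simp add: field_simps)
      then show ?thesis unfolding g_def q by blast
    qed
    also have "(\<zeta> - w) * cnj (\<zeta> - w) = of_real ((cmod (\<zeta> - w))\<^sup>2)"
      using complex_norm_square[of "\<zeta> - w"] by simp
    finally show ?thesis by (simp add: \<zeta>_def)
  qed
  ultimately show ?thesis by simp
qed

text \<open>
  The Poisson kernel is real, so the formula for a holomorphic function passes to its real part,
  and hence to both components of \<open>u\<close>.  The rotation \<open>\<beta>\<close> makes it possible to place the point of
  evaluation on a prescribed ray without shifting the interval of integration.
\<close>

lemma poisson_formula_harmonic:
  fixes u :: "complex \<Rightarrow> complex"
  assumes u: "harmonic_mapping_on (ball a R) u" and "s < R" and w: "cmod w < s" and \<beta>: "cmod \<beta> = 1"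
  shows "((\<lambda>\<theta>. of_real ((s\<^sup>2 - (cmod w)\<^sup>2) / (cmod (s * cis \<theta> - w))\<^sup>2) * u (a + \<beta> * (s * cis \<theta>)))
           has_integral of_real (2 * pi) * u (a + \<beta> * w)) {0..2*pi}"
proof -
  have s: "0 < s" using w norm_ge_zero[of w] by linarith
  define K where "K = (\<lambda>\<theta>. (s\<^sup>2 - (cmod w)\<^sup>2) / (cmod (s * cis \<theta> - w))\<^sup>2)"
  have real: "((\<lambda>\<theta>. K \<theta> * h (a + \<beta> * (s * cis \<theta>))) has_integral 2 * pi * h (a + \<beta> * w)) {0..2*pi}"
    if h: "real_harmonic_on (ball a R) h" for h
  proof -
    obtain f where f: "f holomorphic_on ball a R" "\<And>w. w \<in> ball a R \<Longrightarrow> Re (f w) = h w"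
      using real_harmonic_is_Re_holomorphic[OF open_ball convex_ball h] by blast
    have mem: "a + \<beta> * \<zeta> \<in> ball a R" if "cmod \<zeta> \<le> s" for \<zeta>
      using that \<open>s < R\<close> \<beta> by (simp add: dist_norm norm_mult)
    have "(\<lambda>\<zeta>. a + \<beta> * \<zeta>) ` cball 0 s \<subseteq> ball a R"
      using mem by auto
    then have "(\<lambda>\<zeta>. f (a + \<beta> * \<zeta>)) holomorphic_on cball 0 s"
      by (intro holomorphic_on_compose_gen[OF _ f(1), unfolded o_def] holomorphic_intros)
    from poisson_formula_holomorphic[OF this w]
    have "((\<lambda>\<theta>. of_real (K \<theta>) * f (a + \<beta> * (s * cis \<theta>)))
        has_integral of_real (2 * pi) * f (a + \<beta> * w)) {0..2*pi}"
      by (simp add: K_def)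
    from has_integral_Re[OF this]
    have "((\<lambda>\<theta>. K \<theta> * Re (f (a + \<beta> * (s * cis \<theta>)))) has_integral 2 * pi * Re (f (a + \<beta> * w))) {0..2*pi}"
      by simp
    moreover have "Re (f (a + \<beta> * \<zeta>)) = h (a + \<beta> * \<zeta>)" if "cmod \<zeta> \<le> s" for \<zeta>
      using f(2) mem that by blast
    ultimately show ?thesis using w s by (simp add: norm_mult)
  qed
  have "((\<lambda>\<theta>. of_real (K \<theta> * Re (u (a + \<beta> * (s * cis \<theta>)))) + \<i> * of_real (K \<theta> * Im (u (a + \<beta> * (s * cis \<theta>)))))
      has_integral of_real (2 * pi * Re (u (a + \<beta> * w))) + \<i> * of_real (2 * pi * Im (u (a + \<beta> * w)))) {0..2*pi}"
    using u unfolding harmonic_mapping_on_def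
    by (intro has_integral_add has_integral_mult_right has_integral_of_real real) auto
  moreover have "of_real (k * Re z) + \<i> * of_real (k * Im z) = of_real k * z" for k z
    by (simp add: complex_eq_iff)
  ultimately show ?thesis unfolding K_def by (simp only:)
qed

section \<open>The sharp bound\<close>

text \<open>
  With \<open>b = s\<^sup>2 - r\<^sup>2\<close> the two denominators multiply to \<open>b\<^sup>2 + (2 s r cos \<theta>)\<^sup>2\<close>, so the difference of
  the Poisson kernel at antipodal points has the elementary antiderivative
  \<open>- 2 arctan (2 s r cos \<theta> / b)\<close>.
\<close>

lemma centered_poisson_kernel_integral:
  fixes r s :: real
  assumes "0 < r" "r < s"
  shows "((\<lambda>\<theta>. (s\<^sup>2 - r\<^sup>2) / (s\<^sup>2 + r\<^sup>2 - 2 * s * r * sin \<theta>) - (s\<^sup>2 - r\<^sup>2) / (s\<^sup>2 + r\<^sup>2 + 2 * s * r * sin \<theta>))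
           has_integral 4 * arctan (2 * s * r / (s\<^sup>2 - r\<^sup>2))) {0..pi}"
proof -
  define b where "b = s\<^sup>2 - r\<^sup>2"
  have b: "0 < b" using assms by (simp add: b_def power_strict_mono)
  have "((\<lambda>\<theta>. - 2 * arctan (2 * s * r / b * cos \<theta>)) has_real_derivative
      (s\<^sup>2 - r\<^sup>2) / (s\<^sup>2 + r\<^sup>2 - 2 * s * r * sin \<theta>) - (s\<^sup>2 - r\<^sup>2) / (s\<^sup>2 + r\<^sup>2 + 2 * s * r * sin \<theta>)) (at \<theta>)" for \<theta>
  proof -
    define A where "A = s\<^sup>2 + r\<^sup>2"
    define x where "x = 2 * s * r * sin \<theta>"
    have "\<bar>x\<bar> \<le> 2 * s * r" unfolding x_def using assms by (simp add: abs_mult mult_left_le)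
    moreover have "2 * s * r < A"
      using assms zero_less_power2[of "s - r"] by (simp add: A_def power2_diff)
    ultimately have Ax: "A - x > 0" "A + x > 0" by auto
    have key: "(A - x) * (A + x) = b\<^sup>2 + (2 * s * r * cos \<theta>)\<^sup>2"
    proof -
      have "(A - x) * (A + x) = A\<^sup>2 - (2 * s * r)\<^sup>2 * (sin \<theta>)\<^sup>2" by (simp add: x_def power2_eq_square algebra_simps)
      also have "\<dots> = b\<^sup>2 + (2 * s * r)\<^sup>2 * (cos \<theta>)\<^sup>2"
        unfolding sin_squared_eq A_def b_def by (simp add: power2_eq_square algebra_simps)
      finally show ?thesis by (simp add: power_mult_distrib)
    qed
    have "((\<lambda>\<theta>. - 2 * arctan (2 * s * r / b * cos \<theta>)) has_real_derivative
        - 2 * (2 * s * r / b * - sin \<theta> / (1 + (2 * s * r / b * cos \<theta>)\<^sup>2))) (at \<theta>)"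
      using b by (auto intro!: derivative_eq_intros simp: divide_inverse mult_ac)
    also have "- 2 * (2 * s * r / b * - sin \<theta> / (1 + (2 * s * r / b * cos \<theta>)\<^sup>2)) = 2 * x * b / (b\<^sup>2 + (2 * s * r * cos \<theta>)\<^sup>2)"
    proof -
      have "1 + (2 * s * r / b * cos \<theta>)\<^sup>2 = (b\<^sup>2 + (2 * s * r * cos \<theta>)\<^sup>2) / b\<^sup>2"
        using b by (simp add: power_divide power_mult_distrib add_divide_distrib)
      then show ?thesis using b by (simp add: x_def power2_eq_square)
    qed
    also have "\<dots> = b / (A - x) - b / (A + x)"
      unfolding key[symmetric] using Ax by (simp add: diff_frac_eq algebra_simps)
    finally show ?thesis by (simp add: A_def x_def b_def)
  qed
  then have "((\<lambda>\<theta>. (s\<^sup>2 - r\<^sup>2) / (s\<^sup>2 + r\<^sup>2 - 2 * s * r * sin \<theta>) - (s\<^sup>2 - r\<^sup>2) / (s\<^sup>2 + r\<^sup>2 + 2 * s * r * sin \<theta>))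
     has_integral (- 2 * arctan (2 * s * r / b * cos pi) - (- 2 * arctan (2 * s * r / b * cos 0)))) {0..pi}"
    by (intro fundamental_theorem_of_calculus)
      (auto simp: has_real_derivative_iff_has_vector_derivative[symmetric] intro: has_field_derivative_at_within)
  then show ?thesis by (simp add: b_def arctan_minus)
qed

text \<open>
  The functions here need not have boundary values on the circle of radius \<open>R\<close>, so the estimate is
  made on circles of radius \<open>s < R\<close>.  The evaluation point is put at angle \<open>\<pi>/2\<close>, so that the kernel
  minus the constant \<open>c\<close> is nonnegative on the half circle \<open>[0, \<pi>]\<close> and nonpositive on the other.
\<close>

lemma harmonic_deviation_bound_smaller_circle:
  fixes u :: "complex \<Rightarrow> complex"
  assumes u: "harmonic_mapping_on (ball a R) u" and M: "\<And>w. w \<in> ball a R \<Longrightarrow> cmod (u w) \<le> M"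
    and "0 < r" "r < s" "s < R" and \<beta>: "cmod \<beta> = 1"
  shows "cmod (u (a + \<beta> * (\<i> * r)) - of_real ((s\<^sup>2 - r\<^sup>2) / (s\<^sup>2 + r\<^sup>2)) * u a)
           \<le> 2 * M / pi * arctan (2 * s * r / (s\<^sup>2 - r\<^sup>2))"
proof -
  have s: "0 < s" using assms by linarith
  define c where "c = (s\<^sup>2 - r\<^sup>2) / (s\<^sup>2 + r\<^sup>2)"
  define P where "P = (\<lambda>x. (s\<^sup>2 - r\<^sup>2) / (s\<^sup>2 + r\<^sup>2 - 2 * s * r * x))"
  define v where "v = (\<lambda>\<theta>. u (a + \<beta> * (s * cis \<theta>)))"
  define G where "G = (\<lambda>\<theta>. of_real (P (sin \<theta>) - c) * v \<theta>)"
  define I where "I = of_real (2 * pi) * (u (a + \<beta> * (\<i> * r)) - of_real c * u a)"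
  have v: "cmod (v \<theta>) \<le> M" for \<theta>
    unfolding v_def using s \<beta> \<open>s < R\<close> by (intro M) (simp add: dist_norm norm_mult)
  have dist: "(cmod (s * cis \<theta> - \<i> * r))\<^sup>2 = s\<^sup>2 + r\<^sup>2 - 2 * s * r * sin \<theta>" for \<theta>
  proof -
    have "(cmod (s * cis \<theta> - \<i> * r))\<^sup>2 = s\<^sup>2 * ((sin \<theta>)\<^sup>2 + (cos \<theta>)\<^sup>2) + r\<^sup>2 - 2 * s * r * sin \<theta>"
      unfolding cmod_power2
      by (simp add: power2_eq_square algebra_simps del: sin_cos_squared_add sin_cos_squared_add2 sin_cos_squared_add3)
    then show ?thesis by simp
  qed
  \<comment> \<open>Poisson's formula at \<open>\<i> r\<close> and at the centre, where the kernel is constantly \<open>1\<close>.\<close>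
  have "((\<lambda>\<theta>. of_real (P (sin \<theta>)) * v \<theta>) has_integral of_real (2*pi) * u (a + \<beta> * (\<i> * r))) {0..2*pi}"
    using poisson_formula_harmonic[OF u \<open>s < R\<close> _ \<beta>, of "\<i> * r"] \<open>0 < r\<close> \<open>r < s\<close>
    unfolding dist by (simp add: P_def v_def norm_mult)
  moreover have "(v has_integral of_real (2*pi) * u a) {0..2*pi}"
    using poisson_formula_harmonic[OF u \<open>s < R\<close> _ \<beta>, of 0] s
    by (simp add: v_def norm_mult)
  ultimately have "((\<lambda>\<theta>. of_real (P (sin \<theta>)) * v \<theta> - of_real c * v \<theta>) has_integral
      of_real (2*pi) * u (a + \<beta> * (\<i> * r)) - of_real c * (of_real (2*pi) * u a)) {0..2*pi}"
    by (intro has_integral_diff has_integral_mult_right)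
  then have G: "(G has_integral I) {0..2*pi}"
    by (simp add: G_def I_def algebra_simps)
  then have int: "G integrable_on {0..pi}" "G integrable_on {pi..2*pi}"
    by (auto intro: integrable_on_subinterval[OF has_integral_integrable[OF G]])
  \<comment> \<open>The lower half circle is moved onto the upper one, pairing antipodal points.\<close>
  have "(G has_integral integral {pi..2*pi} G) {pi..2*pi}"
    using int by blast
  then have "((\<lambda>\<theta>. G (\<theta> + pi)) has_integral integral {pi..2*pi} G) {0..pi}"
    using has_integral_shift_real_ivl[of G _ pi "2*pi" pi] by simp
  moreover have "(G has_integral integral {0..pi} G) {0..pi}"
    using int by blast
  moreover have "integral {0..pi} G + integral {pi..2*pi} G = I"
    using Henstock_Kurzweil_Integration.integral_combine[OF _ _ has_integral_integrable[OF G], of pi]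
      integral_unique[OF G] by simp
  ultimately have GG: "((\<lambda>\<theta>. G \<theta> + G (\<theta> + pi)) has_integral I) {0..pi}"
    using has_integral_add[of G _ "{0..pi}" "\<lambda>\<theta>. G (\<theta> + pi)"] by metis
  have bnd: "cmod (G \<theta> + G (\<theta> + pi)) \<le> M * (P (sin \<theta>) - P (- sin \<theta>))" if "\<theta> \<in> {0..pi}" for \<theta>
  proof -
    have sin: "0 \<le> sin \<theta>" "sin \<theta> \<le> 1" using that by (auto intro: sin_ge_zero)
    have "2 * s * r < s\<^sup>2 + r\<^sup>2"
      using assms zero_less_power2[of "s - r"] by (simp add: power2_diff)
    moreover have "2 * s * r * sin \<theta> \<le> 2 * s * r" "0 \<le> 2 * s * r * sin \<theta>"
      using sin s \<open>0 < r\<close> by (auto simp: mult_left_le)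
    moreover have "0 \<le> s\<^sup>2 - r\<^sup>2" using assms by (simp add: power_mono)
    moreover have "0 < s\<^sup>2 + r\<^sup>2" using s by (simp add: add_pos_nonneg)
    \<comment> \<open>The constant \<open>c\<close> is the value of the kernel at angle \<open>0\<close>, and the kernel increases with
      the sine.\<close>
    ultimately have "c \<le> P (sin \<theta>)" "P (- sin \<theta>) \<le> c"
      unfolding c_def P_def by (auto intro!: frac_le)
    then have "cmod (G \<theta>) = (P (sin \<theta>) - c) * cmod (v \<theta>)"
      "cmod (G (\<theta> + pi)) = (c - P (- sin \<theta>)) * cmod (v (\<theta> + pi))"
      by (simp_all add: G_def norm_mult del: of_real_diff)
    moreover have "(P (sin \<theta>) - c) * cmod (v \<theta>) \<le> (P (sin \<theta>) - c) * M"
      "(c - P (- sin \<theta>)) * cmod (v (\<theta> + pi)) \<le> (c - P (- sin \<theta>)) * M"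
      using \<open>c \<le> P (sin \<theta>)\<close> \<open>P (- sin \<theta>) \<le> c\<close> v by (auto intro!: mult_left_mono)
    ultimately show ?thesis
      using norm_triangle_ineq[of "G \<theta>" "G (\<theta> + pi)"] by (simp add: algebra_simps)
  qed
  have K: "((\<lambda>\<theta>. M * (P (sin \<theta>) - P (- sin \<theta>))) has_integral M * (4 * arctan (2 * s * r / (s\<^sup>2 - r\<^sup>2)))) {0..pi}"
    using centered_poisson_kernel_integral[OF \<open>0 < r\<close> \<open>r < s\<close>]
    by (intro has_integral_mult_right) (simp only: P_def mult_minus_right diff_minus_eq_add)
  have "cmod I \<le> M * (4 * arctan (2 * s * r / (s\<^sup>2 - r\<^sup>2)))"
    using integral_norm_bound_integral[OF has_integral_integrable[OF GG] has_integral_integrable[OF K] bnd]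
    unfolding integral_unique[OF GG] integral_unique[OF K] .
  moreover have "cmod I = 2 * pi * cmod (u (a + \<beta> * (\<i> * r)) - of_real c * u a)"
    by (simp add: I_def norm_mult)
  ultimately show ?thesis
    by (simp add: c_def field_simps)
qed

lemma harmonic_deviation_bound:
  fixes u :: "complex \<Rightarrow> complex"
  assumes u: "harmonic_mapping_on (ball a R) u" and M: "\<And>w. w \<in> ball a R \<Longrightarrow> cmod (u w) \<le> M"
    and "0 < r" "r < R" and z: "cmod z = r"
  shows "cmod (u (a + z) - of_real ((R\<^sup>2 - r\<^sup>2) / (R\<^sup>2 + r\<^sup>2)) * u a)
           \<le> 2 * M / pi * arctan (2 * R * r / (R\<^sup>2 - r\<^sup>2))"
proof -
  \<comment> \<open>The rotation that takes the point \<open>\<i> r\<close> to \<open>z\<close>.\<close>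
  define \<beta> where "\<beta> = - \<i> * z / r"
  have \<beta>: "cmod \<beta> = 1"
    using \<open>0 < r\<close> z by (simp add: \<beta>_def norm_mult norm_divide)
  have z\<beta>: "a + \<beta> * (\<i> * r) = a + z"
    using \<open>0 < r\<close> by (simp add: \<beta>_def complex_eq_iff)
  have R: "R\<^sup>2 - r\<^sup>2 \<noteq> 0" "R\<^sup>2 + r\<^sup>2 \<noteq> 0"
    using assms by (auto simp: power2_eq_iff sum_power2_eq_zero_iff)
  have "complex_of_real (R\<^sup>2 + r\<^sup>2) \<noteq> 0"
    using R(2) by (simp only: of_real_eq_0_iff) simp
  then have R': "(complex_of_real R)\<^sup>2 + (complex_of_real r)\<^sup>2 \<noteq> 0" by simp
  have "eventually (\<lambda>s. s \<in> {r<..<R}) (at_left R)"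
    using \<open>r < R\<close> by (rule eventually_at_left_real)
  then have ev: "eventually (\<lambda>s. cmod (u (a + z) - of_real ((s\<^sup>2 - r\<^sup>2) / (s\<^sup>2 + r\<^sup>2)) * u a)
      \<le> 2 * M / pi * arctan (2 * s * r / (s\<^sup>2 - r\<^sup>2))) (at_left R)"
    by eventually_elim
      (use harmonic_deviation_bound_smaller_circle[OF u M \<open>0 < r\<close> _ _ \<beta>] in \<open>auto simp: z\<beta>\<close>)
  show ?thesis
  proof (rule tendsto_le[OF _ _ _ ev])
    show "((\<lambda>s. cmod (u (a + z) - of_real ((s\<^sup>2 - r\<^sup>2) / (s\<^sup>2 + r\<^sup>2)) * u a)) \<longlongrightarrow>
        cmod (u (a + z) - of_real ((R\<^sup>2 - r\<^sup>2) / (R\<^sup>2 + r\<^sup>2)) * u a)) (at_left R)"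
      "((\<lambda>s. 2 * M / pi * arctan (2 * s * r / (s\<^sup>2 - r\<^sup>2))) \<longlongrightarrow> 2 * M / pi * arctan (2*R*r / (R\<^sup>2 - r\<^sup>2))) (at_left R)"
      using R R' by (auto intro!: tendsto_intros)
  qed simp
qed

text \<open>
  The Cayley transform \<open>(1 - \<i> z) / (1 + \<i> z)\<close> maps the unit disk to the right half plane, on which the
  argument stays below \<open>\<pi>/2\<close> in absolute value; the real part of \<open>Arctan z\<close> is half of that argument, up to sign.
\<close>

lemma abs_Re_Arctan_less:
  assumes "cmod z < 1"
  shows "\<bar>Re (Arctan z)\<bar> < pi / 4"
proof -
  have "Re ((1 - \<i> * z) * cnj (1 + \<i> * z)) = 1 - (cmod z)\<^sup>2"
    unfolding cmod_power2 by (simp add: power2_eq_square algebra_simps)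
  also have "\<dots> > 0" using assms by (simp add: abs_square_less_1)
  finally have "0 < Re ((1 - \<i> * z) / (1 + \<i> * z))"
    by (simp only: Re_complex_div_gt_0)
  moreover from this have "(1 - \<i> * z) / (1 + \<i> * z) \<noteq> 0" by auto
  ultimately have "\<bar>Im (Ln ((1 - \<i> * z) / (1 + \<i> * z)))\<bar> < pi / 2"
    using Re_Ln_pos_lt by blast
  then show ?thesis by (simp add: Arctan_def)
qed

text \<open>
  Equality in the estimate calls for the boundary values \<open>M\<close> and \<open>-M\<close>, up to a common unimodular
  factor, on the half circle centred at the direction of \<open>z\<close> and on the opposite one.  The harmonic function with these boundary values is
  the real part of \<open>(4 M / \<pi>) Arctan\<close> on the disk, rotated and scaled to the unit disk.
\<close>

lemma harmonic_deviation_extremal: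
  assumes "0 < r" "r < R" "0 < M" and z: "cmod z = r"
  obtains u where "harmonic_mapping_on (ball a R) u" "\<And>w. w \<in> ball a R \<Longrightarrow> cmod (u w) \<le> M"
    "u a = 0" "u (a + z) = of_real (2 * M / pi * arctan (2 * R * r / (R\<^sup>2 - r\<^sup>2)))"
proof -
  \<comment> \<open>Multiplication by \<open>\<gamma>\<close> scales the radius \<open>R\<close> to \<open>1\<close> and turns \<open>z\<close> to the positive real axis.\<close>
  define \<gamma> where "\<gamma> = cnj z / (r * R)"
  have \<gamma>: "cmod \<gamma> = 1 / R" "\<gamma> * z = of_real (r / R)"
    using assms complex_norm_square[of z]
    by (auto simp: \<gamma>_def norm_divide norm_mult power2_eq_square mult.commute field_simps)
  define F where "F = (\<lambda>w. of_real (4 * M / pi) * Arctan (\<gamma> * (w - a)))"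
  have lt: "cmod (\<gamma> * (w - a)) < 1" if "w \<in> ball a R" for w
    using that assms by (simp add: norm_mult \<gamma> dist_norm norm_minus_commute)
  have arctan_holo: "Arctan holomorphic_on ball 0 1"
    using abs_Im_le_cmod by (intro holomorphic_on_Arctan) (auto intro: le_less_trans)
  have "(\<lambda>w. Arctan (\<gamma> * (w - a))) holomorphic_on ball a R"
    by (rule holomorphic_on_compose_gen[OF _ arctan_holo, unfolded o_def])
      (use lt in \<open>auto intro!: holomorphic_intros\<close>)
  then have F: "F holomorphic_on ball a R"
    unfolding F_def by (intro holomorphic_intros)
  show ?thesis
  proof (rule that[of "\<lambda>w. of_real (Re (F w))"])
    show "harmonic_mapping_on (ball a R) (\<lambda>w. of_real (Re (F w)))"
      unfolding harmonic_mapping_on_def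
      using real_harmonic_on_Re[OF open_ball F] real_harmonic_on_Re[OF open_ball, of "\<lambda>_. 0" a R] by simp
    show "cmod (of_real (Re (F w))) \<le> M" if "w \<in> ball a R" for w
    proof -
      have "\<bar>Re (Arctan (\<gamma> * (w - a)))\<bar> \<le> pi / 4"
        using abs_Re_Arctan_less[OF lt[OF that]] by simp
      then have "4 * M / pi * \<bar>Re (Arctan (\<gamma> * (w - a)))\<bar> \<le> 4 * M / pi * (pi / 4)"
        using assms by (intro mult_left_mono) auto
      moreover have "cmod (of_real (Re (F w))) = 4 * M / pi * \<bar>Re (Arctan (\<gamma> * (w - a)))\<bar>"
        unfolding F_def norm_of_real using assms
        by (simp add: abs_mult Re_divide_of_real)
      ultimately show ?thesis using assms by simp
    qed
    show "of_real (Re (F a)) = (0::complex)" by (simp add: F_def)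
    have "2 * arctan (r / R) = arctan (2 * (r / R) / (1 - (r / R)\<^sup>2))"
      using assms by (intro arctan_double) auto
    also have "2 * (r / R) / (1 - (r / R)\<^sup>2) = 2 * R * r / (R\<^sup>2 - r\<^sup>2)"
      using assms by (simp add: power2_eq_square field_simps)
    finally have "4 * M / pi * arctan (r / R) = 2 * M / pi * arctan (2 * R * r / (R\<^sup>2 - r\<^sup>2))"
      by (simp add: field_simps)
    then show "of_real (Re (F (a + z))) = of_real (2 * M / pi * arctan (2 * R * r / (R\<^sup>2 - r\<^sup>2)))"
      by (simp only: F_def add_diff_cancel_left' \<gamma> Arctan_of_real of_real_mult[symmetric] Re_complex_of_real)
  qed
qed

theorem theorem4p2:
  fixes a z :: complex and r R M t :: real
  assumes "0 < r" and "r < R" and "0 < M"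
    and "z = complex_of_real r * exp (\<i> * complex_of_real t)"
  shows "(\<forall>u :: complex \<Rightarrow> complex.
            harmonic_mapping_on (ball a R) u \<and> (\<forall>w\<in>ball a R. cmod (u w) \<le> M) \<longrightarrow>
            cmod (u (a + z) - complex_of_real ((R\<^sup>2 - (cmod z)\<^sup>2) / (R\<^sup>2 + (cmod z)\<^sup>2)) * u a)
              \<le> 2 * M / pi * arctan (2 * R * cmod z / (R\<^sup>2 - (cmod z)\<^sup>2)))
       \<and> (\<exists>u :: complex \<Rightarrow> complex.
            harmonic_mapping_on (ball a R) u \<and> (\<forall>w\<in>ball a R. cmod (u w) \<le> M) \<and>
            cmod (u (a + z) - complex_of_real ((R\<^sup>2 - (cmod z)\<^sup>2) / (R\<^sup>2 + (cmod z)\<^sup>2)) * u a)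
              = 2 * M / pi * arctan (2 * R * cmod z / (R\<^sup>2 - (cmod z)\<^sup>2)))"
proof -
  have z: "cmod z = r" using assms by (simp add: norm_mult)
  obtain u where u: "harmonic_mapping_on (ball a R) u" "\<And>w. w \<in> ball a R \<Longrightarrow> cmod (u w) \<le> M"
    "u a = 0" "u (a + z) = of_real (2 * M / pi * arctan (2 * R * r / (R\<^sup>2 - r\<^sup>2)))"
    using harmonic_deviation_extremal[OF assms(1-3) z] by blast
  have "r\<^sup>2 < R\<^sup>2" using assms by (simp add: power_strict_mono)
  then have "0 \<le> 2 * M / pi * arctan (2 * R * r / (R\<^sup>2 - r\<^sup>2))"
    using assms by (intro mult_nonneg_nonneg) (auto simp: zero_le_arctan_iff)
  then have "cmod (u (a + z) - of_real ((R\<^sup>2 - (cmod z)\<^sup>2) / (R\<^sup>2 + (cmod z)\<^sup>2)) * u a)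
              = 2 * M / pi * arctan (2 * R * cmod z / (R\<^sup>2 - (cmod z)\<^sup>2))"
    unfolding u(3,4) z by (simp only: mult_zero_right diff_zero norm_of_real abs_of_nonneg)
  then show ?thesis
    using harmonic_deviation_bound[OF _ _ assms(1,2) z, where M = M] u(1,2) unfolding z by blast
qed

end
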